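(* Let $X$ be a reflexive Banach space which satisfies the Kadec-Klee property. Then: (i) $S_{\mathcal{K}(X,Y)}\subset\mathcal{A}_{\|\cdot\|}(X,Y)$ for every Banach space $Y$. (ii) $\{T\in\mathcal{K}(X):\nu(T)=\|T\|=1\}\subset\mathcal{A}_{\mathrm{nu}}(X)$ whenever (the norm of) $X$ is Fréchet differentiable.
   Context: Banach spaces are over $\mathbb{K}=\mathbb{R}$ or $\mathbb{C}$; $S_X$ is the unit sphere of $X$, $X^*$ the topological dual, $\mathcal{L}(X,Y)$ the bounded linear operators from $X$ to $Y$, $\mathcal{K}(X,Y)$ the space of compact operators from $X$ to $Y$ with the operator norm, $\mathcal{L}(X)=\mathcal{L}(X,X)$, $\mathcal{K}(X)=\mathcal{K}(X,X)$, and $\langle x^*,x\rangle=x^*(x)$. $X$ satisfies the Kadec-Klee property when the weak and norm topologies coincide on $S_X$. $X$ is Fréchet differentiable when its norm is Fréchet differentiable at every point of $S_X$. An operator $T\in\mathcal{L}(X,Y)$ attains its norm if $\|T(x_0)\|=\|T\|$ for some $x_0\in S_X$. Let $\Pi(X)=\{(x,x^* )\in S_X\times S_{X^*}:\langle x^*,x\rangle=1\}$ and, for $T\in\mathcal{L}(X)$, $\nu(T)=\sup\{|\langle x^*,T(x)\rangle|:(x,x^* )\in\Pi(X)\}$; $T$ attains its numerical radius if this supremum is attained. $\mathcal{A}_{\|\cdot\|}(X,Y)$ is the set of all norm-attaining $T\in\mathcal{L}(X,Y)$ with $\|T\|=1$ such that for every $\varepsilon>0$ there is $\eta(\varepsilon,T)>0$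 such that whenever $x\in S_X$ satisfies $\|T(x)\|>1-\eta(\varepsilon,T)$, there is $x_0\in S_X$ with $\|T(x_0)\|=1$ and $\|x_0-x\|<\varepsilon$. $\mathcal{A}_{\mathrm{nu}}(X)$ is the set of all numerical radius attaining $T\in\mathcal{L}(X)$ with $\nu(T)=1$ such that for every $\varepsilon>0$ there is $\eta(\varepsilon,T)>0$ such that whenever $(x,x^* )\in\Pi(X)$ satisfies $|\langle x^*,T(x)\rangle|>1-\eta(\varepsilon,T)$, there is $(x_0,x_0^* )\in\Pi(X)$ with $|\langle x_0^*,T(x_0)\rangle|=1$, $\|x_0-x\|<\varepsilon$ and $\|x_0^*-x^*\|<\varepsilon$. *)

theory Defs
  imports "HOL-Analysis.Analysis"
begin

(* The scalar field K: to_complex identifies it, as a normed field, with R or with C. *)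
class rc_field = real_normed_field +
  fixes to_complex :: "'a \<Rightarrow> complex"
  assumes to_complex_add: "to_complex (x + y) = to_complex x + to_complex y"
    and to_complex_mult: "to_complex (x * y) = to_complex x * to_complex y"
    and to_complex_scaleR: "to_complex (r *\<^sub>R x) = r *\<^sub>R to_complex x"
    and norm_to_complex: "norm (to_complex x) = norm x"
    and range_to_complex: "range to_complex = \<real> \<or> range to_complex = UNIV"

instantiation real :: rc_field
begin
definition to_complex_real :: "real \<Rightarrow> complex" where "to_complex_real = complex_of_real"
instance
  by standard (auto simp: to_complex_real_def Reals_def scaleR_conv_of_real)
end

instantiation complex :: rc_field
begin
definition to_complex_complex :: "complex \<Rightarrow> complex" where "to_complex_complex = id"
instance
  by standard (auto simp: to_complex_complex_def)
end

(* A Banach space over K. Its underlying real Banach space is the one given by the class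
   banach; for K = R the last axiom forces scale = scaleR. *)
locale banach_over = vector_space scale
  for scale :: "'k::rc_field \<Rightarrow> 'a::banach \<Rightarrow> 'a" +
  assumes norm_scale: "norm (scale c x) = norm c * norm x"
    and scale_of_real: "scale (of_real r) x = r *\<^sub>R x"

lemma banach_over_real: "banach_over ((*\<^sub>R) :: real \<Rightarrow> 'a::banach \<Rightarrow> 'a)"
  by unfold_locales (auto simp: algebra_simps)

(* Elements of the type of blinfuns are only real-linear; for K = C linearity over K
   is an extra requirement. The operator norm is the norm of that type. *)
definition bounded_operators ::
  "('k::rc_field \<Rightarrow> 'a::banach \<Rightarrow> 'a) \<Rightarrow> ('k \<Rightarrow> 'b::banach \<Rightarrow> 'b) \<Rightarrow> ('a \<Rightarrow>\<^sub>L 'b) set" where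
  "bounded_operators sX sY = {T. Vector_Spaces.linear sX sY (blinfun_apply T)}"

definition compact_operators ::
  "('k::rc_field \<Rightarrow> 'a::banach \<Rightarrow> 'a) \<Rightarrow> ('k \<Rightarrow> 'b::banach \<Rightarrow> 'b) \<Rightarrow> ('a \<Rightarrow>\<^sub>L 'b) set" where
  "compact_operators sX sY =
     {T \<in> bounded_operators sX sY. compact (closure (blinfun_apply T ` cball 0 1))}"

definition dual_space :: "('k::rc_field \<Rightarrow> 'a::banach \<Rightarrow> 'a) \<Rightarrow> ('a \<Rightarrow>\<^sub>L 'k) set" where
  "dual_space sX = {f. Vector_Spaces.linear sX (*) (blinfun_apply f)}"

(* Bounded K-linear functionals on the dual space; their values outside dual_space are irrelevant. *)
definition bidual_space ::
  "('k::rc_field \<Rightarrow> 'a::banach \<Rightarrow> 'a) \<Rightarrow> (('a \<Rightarrow>\<^sub>L 'k) \<Rightarrow> 'k) set" where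
  "bidual_space sX = {\<phi>.
     (\<forall>f\<in>dual_space sX. \<forall>g\<in>dual_space sX. \<phi> (f + g) = \<phi> f + \<phi> g) \<and>
     (\<forall>c. \<forall>f\<in>dual_space sX. \<phi> (blinfun_mult_right c o\<^sub>L f) = c * \<phi> f) \<and>
     (\<exists>B. \<forall>f\<in>dual_space sX. norm (\<phi> f) \<le> B * norm f)}"

(* Surjectivity of the canonical embedding into the bidual. *)
definition reflexive_space :: "('k::rc_field \<Rightarrow> 'a::banach \<Rightarrow> 'a) \<Rightarrow> bool" where
  "reflexive_space sX \<longleftrightarrow>
     (\<forall>\<phi>\<in>bidual_space sX. \<exists>x. \<forall>f\<in>dual_space sX. \<phi> f = blinfun_apply f x)"

definition weak_topology :: "('k::rc_field \<Rightarrow> 'a::banach \<Rightarrow> 'a) \<Rightarrow> 'a topology" where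
  "weak_topology sX =
     topology_generated_by {blinfun_apply f -` U | f U. f \<in> dual_space sX \<and> open U}"

definition kadec_klee :: "('k::rc_field \<Rightarrow> 'a::banach \<Rightarrow> 'a) \<Rightarrow> bool" where
  "kadec_klee sX \<longleftrightarrow>
     subtopology (weak_topology sX) (sphere 0 1) = top_of_set (sphere 0 1)"

definition frechet_differentiable_norm :: "'a::banach itself \<Rightarrow> bool" where
  "frechet_differentiable_norm _ \<longleftrightarrow>
     (\<forall>x\<in>sphere (0::'a) 1. (norm :: 'a \<Rightarrow> real) differentiable (at x))"

definition norm_attaining :: "('a::banach \<Rightarrow>\<^sub>L 'b::banach) \<Rightarrow> bool" where
  "norm_attaining T \<longleftrightarrow> (\<exists>x0\<in>sphere 0 1. norm (blinfun_apply T x0) = norm T)"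

definition Pi_states ::
  "('k::rc_field \<Rightarrow> 'a::banach \<Rightarrow> 'a) \<Rightarrow> ('a \<times> ('a \<Rightarrow>\<^sub>L 'k)) set" where
  "Pi_states sX =
     {(x, f). norm x = 1 \<and> f \<in> dual_space sX \<and> norm f = 1 \<and> blinfun_apply f x = 1}"

definition numerical_radius ::
  "('k::rc_field \<Rightarrow> 'a::banach \<Rightarrow> 'a) \<Rightarrow> ('a \<Rightarrow>\<^sub>L 'a) \<Rightarrow> real" where
  "numerical_radius sX T =
     (SUP (x, f)\<in>Pi_states sX. norm (blinfun_apply f (blinfun_apply T x)))"

definition numerical_radius_attaining ::
  "('k::rc_field \<Rightarrow> 'a::banach \<Rightarrow> 'a) \<Rightarrow> ('a \<Rightarrow>\<^sub>L 'a) \<Rightarrow> bool" where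
  "numerical_radius_attaining sX T \<longleftrightarrow>
     (\<exists>(x, f)\<in>Pi_states sX.
        norm (blinfun_apply f (blinfun_apply T x)) = numerical_radius sX T)"

definition A_norm ::
  "('k::rc_field \<Rightarrow> 'a::banach \<Rightarrow> 'a) \<Rightarrow> ('k \<Rightarrow> 'b::banach \<Rightarrow> 'b) \<Rightarrow> ('a \<Rightarrow>\<^sub>L 'b) set" where
  "A_norm sX sY = {T \<in> bounded_operators sX sY. norm_attaining T \<and> norm T = 1 \<and>
     (\<forall>\<epsilon>>0. \<exists>\<eta>>0. \<forall>x\<in>sphere 0 1. norm (blinfun_apply T x) > 1 - \<eta> \<longrightarrow>
        (\<exists>x0\<in>sphere 0 1. norm (blinfun_apply T x0) = 1 \<and> norm (x0 - x) < \<epsilon>))}"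

definition A_nu :: "('k::rc_field \<Rightarrow> 'a::banach \<Rightarrow> 'a) \<Rightarrow> ('a \<Rightarrow>\<^sub>L 'a) set" where
  "A_nu sX = {T \<in> bounded_operators sX sX.
     numerical_radius_attaining sX T \<and> numerical_radius sX T = 1 \<and>
     (\<forall>\<epsilon>>0. \<exists>\<eta>>0. \<forall>(x, f)\<in>Pi_states sX.
        norm (blinfun_apply f (blinfun_apply T x)) > 1 - \<eta> \<longrightarrow>
        (\<exists>(x0, f0)\<in>Pi_states sX. norm (blinfun_apply f0 (blinfun_apply T x0)) = 1 \<and>
           norm (x0 - x) < \<epsilon> \<and> norm (f0 - f) < \<epsilon>))}"

end

theory Submission imports Defs begin

text \<open>Let \<open>norm (T (x n)) \<longlonglongrightarrow> 1\<close> on the unit sphere. Tychonoff's theorem and reflexivity give a filter \<open>G\<close>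
  finer than \<open>sequentially\<close> along which \<open>x\<close> converges weakly to some \<open>a\<close> (filters replace the
  subsequences of the Eberlein--Shmulyan theorem), and by compactness \<open>T (x n)\<close> converges to \<open>T a\<close>
  in norm. Hence \<open>norm (T a) = 1\<close>, which forces \<open>norm a = 1\<close>, and the Kadec--Klee property makes \<open>x\<close>
  converge to \<open>a\<close> in norm; this contradicts a failure of (i) along \<open>x\<close>. For (ii), Frechet
  differentiability at \<open>a\<close> makes the functionals of the states \<open>(x n, f n)\<close> converge in norm to the
  support functional of \<open>a\<close>.\<close>

section \<open>The Hahn--Banach theorem for sublinear functionals\<close>

definition sublinear :: "('a::real_vector \<Rightarrow> real) \<Rightarrow> bool" where
  "sublinear q \<longleftrightarrow> (\<forall>x y. q (x + y) \<le> q x + q y) \<and> (\<forall>t\<ge>0. \<forall>x. q (t *\<^sub>R x) = t * q x)"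

lemma sublinear_add: "sublinear q \<Longrightarrow> q (x + y) \<le> q x + q y"
  by (simp add: sublinear_def)

lemma sublinear_scaleR: "sublinear q \<Longrightarrow> 0 \<le> t \<Longrightarrow> q (t *\<^sub>R x) = t * q x"
  by (simp add: sublinear_def)

lemma sublinear_zero: "sublinear q \<Longrightarrow> q 0 = 0"
  using sublinear_scaleR[of q 0 0] by simp

lemma sublinear_neg_le: "sublinear q \<Longrightarrow> - q (- x) \<le> q x"
  using sublinear_add[of q x "- x"] sublinear_zero[of q] by simp

text \<open>Applying the inequality to \<open>t *\<^sub>R x\<close> with factor
  \<open>inverse t\<close> gives its converse.\<close>

lemma sublinearI:
  assumes add: "\<And>x y. q (x + y) \<le> q x + q y"
    and scale: "\<And>t x. 0 < t \<Longrightarrow> q (t *\<^sub>R x) \<le> t * q x"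
    and zero: "q 0 = 0"
  shows "sublinear q"
proof -
  have "q (t *\<^sub>R x) = t * q x" if "0 \<le> t" for t x
  proof (cases "t = 0")
    case False
    with that have t: "0 < t" by simp
    have "q x = q (inverse t *\<^sub>R (t *\<^sub>R x))" using t by simp
    also have "\<dots> \<le> inverse t * q (t *\<^sub>R x)" using t by (intro scale) simp
    finally have "t * q x \<le> q (t *\<^sub>R x)" using t by (simp add: field_simps)
    with scale[OF t, of x] show ?thesis by simp
  qed (simp add: zero)
  with add show ?thesis by (simp add: sublinear_def)
qed

lemma sublinear_norm: "sublinear norm"
  by (rule sublinearI) (auto simp: norm_triangle_ineq)

text \<open>The largest sublinear functional \<open>q \<le> p\<close> with \<open>q (- y) \<le> - p y\<close>; a minimal \<open>p\<close> coincides
  with it for every \<open>y\<close>, which makes \<open>p\<close> additive.\<close>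

definition lower_sublinear :: "('a::real_vector \<Rightarrow> real) \<Rightarrow> 'a \<Rightarrow> 'a \<Rightarrow> real" where
  "lower_sublinear p y z = (INF t\<in>{0..}. p (z + t *\<^sub>R y) - t * p y)"

lemma lower_sublinear_le:
  assumes p: "sublinear p" and t: "0 \<le> t"
  shows "lower_sublinear p y z \<le> p (z + t *\<^sub>R y) - t * p y"
proof -
  \<comment> \<open>This bound makes the infimum meaningful. It comes from writing
    \<open>s *\<^sub>R y\<close> as \<open>(z + s *\<^sub>R y) + (- z)\<close>.\<close>
  have "- p (- z) \<le> p (z + s *\<^sub>R y) - s * p y" if "0 \<le> s" for s
    using sublinear_add[OF p, of "z + s *\<^sub>R y" "- z"] sublinear_scaleR[OF p that, of y] by simp
  then have "bdd_below ((\<lambda>s. p (z + s *\<^sub>R y) - s * p y) ` {0..})"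
    by (intro bdd_belowI2[where m = "- p (- z)"]) auto
  then show ?thesis unfolding lower_sublinear_def using t by (intro cINF_lower) auto
qed

lemma lower_sublinear_greatest:
  assumes "\<And>t. 0 \<le> t \<Longrightarrow> m \<le> p (z + t *\<^sub>R y) - t * p y"
  shows "m \<le> lower_sublinear p y z"
  unfolding lower_sublinear_def using assms by (intro cINF_greatest) auto

text \<open>Parameters \<open>s\<close> for \<open>z\<close> and \<open>t\<close> for
  \<open>w\<close> combine to \<open>s + t\<close> for \<open>z + w\<close>, and \<open>t\<close>
  for \<open>z\<close> becomes \<open>c * t\<close> for \<open>c *\<^sub>R z\<close>.\<close>

lemma sublinear_lower_sublinear:
  assumes p: "sublinear p"
  shows "sublinear (lower_sublinear p y)"
proof (rule sublinearI)
  let ?q = "lower_sublinear p y"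
  fix z w :: 'a
  have *: "?q (z + w) \<le> (p (z + s *\<^sub>R y) - s * p y) + (p (w + t *\<^sub>R y) - t * p y)"
    if "0 \<le> s" "0 \<le> t" for s t
  proof -
    have "?q (z + w) \<le> p ((z + w) + (s + t) *\<^sub>R y) - (s + t) * p y"
      using that by (intro lower_sublinear_le[OF p]) simp
    moreover have "(z + w) + (s + t) *\<^sub>R y = (z + s *\<^sub>R y) + (w + t *\<^sub>R y)"
      by (simp add: algebra_simps)
    ultimately show ?thesis
      using sublinear_add[OF p, of "z + s *\<^sub>R y" "w + t *\<^sub>R y"] by (simp add: algebra_simps)
  qed
  have "?q (z + w) - (p (w + t *\<^sub>R y) - t * p y) \<le> ?q z" if "0 \<le> t" for t
    using *[OF _ that] by (intro lower_sublinear_greatest) (simp add: algebra_simps)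
  then have "?q (z + w) - ?q z \<le> ?q w"
    by (intro lower_sublinear_greatest) (simp add: algebra_simps)
  then show "?q (z + w) \<le> ?q z + ?q w" by simp
next
  let ?q = "lower_sublinear p y"
  fix c :: real and z :: 'a
  assume c: "0 < c"
  have "inverse c * ?q (c *\<^sub>R z) \<le> ?q z"
  proof (rule lower_sublinear_greatest)
    fix t :: real assume t: "0 \<le> t"
    have "?q (c *\<^sub>R z) \<le> p (c *\<^sub>R z + (c * t) *\<^sub>R y) - (c * t) * p y"
      using c t by (intro lower_sublinear_le[OF p]) simp
    also have "c *\<^sub>R z + (c * t) *\<^sub>R y = c *\<^sub>R (z + t *\<^sub>R y)" by (simp add: algebra_simps)
    also have "p \<dots> = c * p (z + t *\<^sub>R y)" using c by (intro sublinear_scaleR[OF p]) simp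
    finally show "inverse c * ?q (c *\<^sub>R z) \<le> p (z + t *\<^sub>R y) - t * p y"
      using c by (simp add: field_simps)
  qed
  then show "?q (c *\<^sub>R z) \<le> c * ?q z" using c by (simp add: field_simps)
next
  have "lower_sublinear p y 0 \<le> 0"
    using lower_sublinear_le[OF p order_refl, of y 0] sublinear_zero[OF p] by simp
  moreover have "0 \<le> lower_sublinear p y 0"
    using sublinear_scaleR[OF p] by (intro lower_sublinear_greatest) simp
  ultimately show "lower_sublinear p y 0 = 0" by simp
qed

text \<open>The smaller of two members of a chain lies below both, so the infimum at
  \<open>x + y\<close> is at most \<open>q x + r y\<close> with \<open>q\<close> and
  \<open>r\<close> chosen independently.\<close>

lemma sublinear_INF_chain:
  fixes C :: "('a::real_vector \<Rightarrow> real) set"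
  assumes "C \<noteq> {}" and sub: "\<And>q. q \<in> C \<Longrightarrow> sublinear q"
    and chain: "\<And>q r. q \<in> C \<Longrightarrow> r \<in> C \<Longrightarrow> q \<le> r \<or> r \<le> q"
    and bdd: "\<And>x. bdd_below ((\<lambda>q. q x) ` C)"
  shows "sublinear (\<lambda>x. INF q\<in>C. q x)"
proof (rule sublinearI)
  let ?m = "\<lambda>x. INF q\<in>C. q x"
  have le: "?m x \<le> q x" if "q \<in> C" for q x
    using bdd that by (rule cINF_lower)
  fix x y :: 'a
  have *: "?m (x + y) \<le> q x + r y" if q: "q \<in> C" and r: "r \<in> C" for q r
  proof -
    obtain s where s: "s \<in> C" "s \<le> q" "s \<le> r" using chain[OF q r] q r by blast
    have "?m (x + y) \<le> s (x + y)" using s(1) by (rule le)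
    also have "\<dots> \<le> s x + s y" using sub[OF s(1)] by (rule sublinear_add)
    also have "\<dots> \<le> q x + r y" using s(2,3) by (intro add_mono) (simp_all add: le_fun_def)
    finally show ?thesis .
  qed
  have "?m (x + y) - r y \<le> ?m x" if "r \<in> C" for r
    using *[OF _ that] \<open>C \<noteq> {}\<close> by (intro cINF_greatest) (auto simp: algebra_simps)
  then have "?m (x + y) - ?m x \<le> ?m y"
    using \<open>C \<noteq> {}\<close> by (intro cINF_greatest) (auto simp: algebra_simps)
  then show "?m (x + y) \<le> ?m x + ?m y" by simp
next
  let ?m = "\<lambda>x. INF q\<in>C. q x"
  fix t :: real and x :: 'a
  assume t: "0 < t"
  have "inverse t * ?m (t *\<^sub>R x) \<le> ?m x"
  proof (rule cINF_greatest[OF \<open>C \<noteq> {}\<close>])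
    fix q assume q: "q \<in> C"
    have "?m (t *\<^sub>R x) \<le> q (t *\<^sub>R x)" using bdd q by (rule cINF_lower)
    also have "\<dots> = t * q x" using sub[OF q] t by (simp add: sublinear_scaleR)
    finally show "inverse t * ?m (t *\<^sub>R x) \<le> q x" using t by (simp add: field_simps)
  qed
  then show "?m (t *\<^sub>R x) \<le> t * ?m x" using t by (simp add: field_simps)
next
  have "(\<lambda>q. q 0) ` C = {0::real}" using sub \<open>C \<noteq> {}\<close> by (force simp: sublinear_zero)
  then show "(INF q\<in>C. q 0) = (0::real)" by simp
qed

text \<open>Zorn's lemma is applied to sublinear functionals rather than to partial extensions: a
  minimal one is already linear on the whole space.\<close>

theorem hahn_banach_sublinear:
  fixes p :: "'a::real_vector \<Rightarrow> real"
  assumes p: "sublinear p"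
  shows "\<exists>u. linear u \<and> (\<forall>y. u y \<le> p y) \<and> u x = p x"
proof -
  \<comment> \<open>The last condition fixes the value at \<open>x\<close>: for linear
    \<open>u\<close> it reads \<open>p x \<le> u x\<close>, and \<open>u \<le> p\<close> gives the
    rest.\<close>
  define A where "A = {q. sublinear q \<and> q \<le> p \<and> q (- x) \<le> - p x}"
  \<comment> \<open>The order is reversed, since Zorn's lemma yields maximal elements.\<close>
  define P where "P = (\<lambda>q r :: 'a \<Rightarrow> real. r \<le> q)"
  \<comment> \<open>A bound common to all of \<open>A\<close>, so that pointwise infima over chains
    exist.\<close>
  have below: "- p (- z) \<le> q z" if "q \<in> A" for q z
  proof -
    have "q (- z) \<le> p (- z)" using that by (simp add: A_def le_fun_def)
    then show ?thesis using that sublinear_neg_le[of q z] by (simp add: A_def)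
  qed
  have A_lower: "lower_sublinear q y \<in> A \<and> lower_sublinear q y \<le> q" if "q \<in> A" for q y
  proof -
    have q: "sublinear q" using that by (simp add: A_def)
    have le: "lower_sublinear q y \<le> q"
      using lower_sublinear_le[OF q order_refl, of y] by (simp add: le_fun_def)
    then have "lower_sublinear q y (- x) \<le> q (- x)" by (simp add: le_fun_def)
    then show ?thesis
      using that le sublinear_lower_sublinear[OF q, of y] by (auto simp: A_def)
  qed
  have ne: "lower_sublinear p x \<in> A"
  proof -
    \<comment> \<open>With parameter 1 the argument \<open>- x + x\<close> vanishes, which leaves
      \<open>- p x\<close>.\<close>
    have "lower_sublinear p x (- x) \<le> - p x"
      using lower_sublinear_le[OF p, of 1 x "- x"] sublinear_zero[OF p] by simp
    moreover have "lower_sublinear p x \<le> p"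
      using lower_sublinear_le[OF p order_refl, of x] by (simp add: le_fun_def)
    ultimately show ?thesis
      using sublinear_lower_sublinear[OF p, of x] by (simp add: A_def)
  qed
  have "\<exists>m\<in>A. \<forall>a\<in>A. P m a \<longrightarrow> a = m"
  proof (rule predicate_Zorn)
    show "partial_order_on A (relation_of P A)"
      by (rule partial_order_on_relation_ofI) (auto simp: P_def)
  next
    fix C assume C: "C \<in> Chains (relation_of P A)"
    have CA: "C \<subseteq> A" using C by (rule Chains_relation_of)
    show "\<exists>u\<in>A. \<forall>a\<in>C. P a u"
    proof (cases "C = {}")
      case True
      then show ?thesis using ne by blast
    next
      case False
      let ?m = "\<lambda>x. INF q\<in>C. q x"
      have bdd: "bdd_below ((\<lambda>q. q z) ` C)" for z
        using below CA by (intro bdd_belowI2[where m = "- p (- z)"]) blast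
      have le: "?m \<le> q" if "q \<in> C" for q
        by (intro le_funI cINF_lower bdd that)
      have "sublinear ?m"
      proof (rule sublinear_INF_chain[OF False _ _ bdd])
        show "sublinear q" if "q \<in> C" for q using that CA by (auto simp: A_def)
        show "q \<le> r \<or> r \<le> q" if "q \<in> C" "r \<in> C" for q r
          using C that by (auto simp: Chains_def relation_of_def P_def)
      qed
      moreover obtain q where q: "q \<in> C" using False by blast
      then have "?m \<le> p" "?m (- x) \<le> - p x"
        using le[OF q] CA by (auto simp: A_def le_fun_def intro: order_trans)
      ultimately have "?m \<in> A" by (simp add: A_def)
      then show ?thesis using le unfolding P_def by blast
    qed
  qed
  then obtain u where u: "u \<in> A" and min: "\<And>a. a \<in> A \<Longrightarrow> a \<le> u \<Longrightarrow> a = u"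
    unfolding P_def by blast
  have sub: "sublinear u" using u by (simp add: A_def)
  have add: "u (z + y) = u z + u y" for z y
  proof -
    have "lower_sublinear u y = u" using A_lower[OF u] min by blast
    then have "u z \<le> u (z + y) - u y"
      using lower_sublinear_le[OF sub, of 1 y z] by simp
    then show ?thesis using sublinear_add[OF sub, of z y] by simp
  qed
  have neg: "u (- z) = - u z" for z
    using add[of z "- z"] sublinear_zero[OF sub] by simp
  have "linear u"
  proof (rule linearI)
    show "u (r *\<^sub>R z) = r *\<^sub>R u z" for r z
    proof (cases "0 \<le> r")
      case False
      then have "u ((- r) *\<^sub>R z) = (- r) * u z" by (intro sublinear_scaleR[OF sub]) simp
      then show ?thesis using neg[of "r *\<^sub>R z"] by simp
    qed (simp add: sublinear_scaleR[OF sub])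
  qed (rule add)
  moreover have "\<forall>y. u y \<le> p y" using u by (simp add: A_def le_fun_def)
  moreover have "u x = p x"
    using u neg[of x] calculation(2) by (auto simp: A_def intro: antisym)
  ultimately show ?thesis by blast
qed

section \<open>Scalars and norming functionals\<close>

text \<open>Multiplicativity makes the image of 1 an idempotent, and preservation of the norm
  excludes 0.\<close>

lemma to_complex_1 [simp]: "to_complex (1::'k::rc_field) = 1"
proof -
  have "to_complex (1::'k) * to_complex (1::'k) = to_complex (1::'k)"
    using to_complex_mult[of "1::'k" 1] by simp
  moreover have "to_complex (1::'k) \<noteq> 0"
    using norm_to_complex[of "1::'k"] by auto
  ultimately show ?thesis by simp
qed

lemma to_complex_of_real [simp]: "to_complex (of_real r :: 'k::rc_field) = of_real r"
  using to_complex_scaleR[of r "1::'k"] by (simp add: of_real_def)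

lemma bounded_linear_to_complex: "bounded_linear (to_complex :: 'k::rc_field \<Rightarrow> complex)"
  by (rule bounded_linear_intro[where K = 1])
    (auto simp: to_complex_add to_complex_scaleR norm_to_complex)

lemma to_complex_diff: "to_complex (x - y) = to_complex x - to_complex (y::'k::rc_field)"
  by (rule linear_diff[OF bounded_linear.linear[OF bounded_linear_to_complex]])

lemma to_complex_eq_iff: "to_complex x = to_complex y \<longleftrightarrow> x = (y::'k::rc_field)"
  by (metis eq_iff_diff_eq_0 norm_eq_zero norm_to_complex to_complex_diff)

text \<open>\<open>to_complex\<close> is an isometry onto a closed subset of the complex plane, so
  its inverse carries a compact set onto the ball. These balls are the factors in the later
  Tychonoff argument.\<close>

lemma compact_cball_rc_field: "compact (cball (0::'k::rc_field) r)"
proof -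
  let ?t = "to_complex :: 'k \<Rightarrow> complex"
  have inj: "inj ?t" by (auto simp: inj_def to_complex_eq_iff)
  have "closed (range ?t)"
    using range_to_complex[where 'a = 'k] closed_complex_Reals by auto
  then have cpt: "compact (cball 0 r \<inter> range ?t)" by (intro compact_Int_closed) auto
  have "continuous_on (range ?t) (inv ?t)"
    unfolding continuous_on_iff
    by (auto simp: inv_f_f[OF inj] dist_norm norm_to_complex simp flip: to_complex_diff)
  then have "compact (inv ?t ` (cball 0 r \<inter> range ?t))"
    by (intro compact_continuous_image[OF _ cpt]) (auto elim: continuous_on_subset)
  also have "inv ?t ` (cball 0 r \<inter> range ?t) = cball 0 r"
  proof (intro set_eqI iffI)
    fix z :: 'k assume "z \<in> cball 0 r"
    then have "?t z \<in> cball 0 r \<inter> range ?t" by (simp add: norm_to_complex)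
    then show "z \<in> inv ?t ` (cball 0 r \<inter> range ?t)"
      by (rule rev_image_eqI) (simp add: inv_f_f[OF inj])
  qed (auto simp: inv_f_f[OF inj] norm_to_complex)
  finally show ?thesis .
qed

text \<open>The real part never exceeds the modulus, so the inequalities are equalities and the
  imaginary part vanishes.\<close>

lemma eq_of_real_if_Re_ge_norm:
  assumes "norm z \<le> r" "r \<le> Re (to_complex (z::'k::rc_field))"
  shows "z = of_real r"
proof -
  have 1: "cmod (to_complex z) \<le> Re (to_complex z)" using assms by (simp add: norm_to_complex)
  have "r = Re (to_complex z)"
    using assms complex_Re_le_cmod[of "to_complex z"] by (simp add: norm_to_complex)
  moreover have "Im (to_complex z) = 0"
  proof -
    have "(cmod (to_complex z))\<^sup>2 \<le> (Re (to_complex z))\<^sup>2"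
      using 1 by (intro power_mono) auto
    then show ?thesis by (simp add: cmod_power2)
  qed
  ultimately have "to_complex z = to_complex (of_real r :: 'k)"
    by (simp add: complex_eq_iff)
  then show ?thesis by (simp only: to_complex_eq_iff)
qed

section \<open>Functionals over K and the Hahn-Banach theorem for them\<close>

lemma dual_spaceD:
  assumes "f \<in> dual_space sX"
  shows "blinfun_apply f (x + y) = blinfun_apply f x + blinfun_apply f y"
    "blinfun_apply f (sX c x) = c * blinfun_apply f x"
  using assms by (auto simp: dual_space_def Vector_Spaces.linear_iff)

context banach_over
begin

lemma vector_space_mult: "vector_space ((*) :: 'k \<Rightarrow> 'k \<Rightarrow> 'k)"
  by unfold_locales (auto simp: algebra_simps)

lemma dual_spaceI:
  assumes "\<And>x y. blinfun_apply f (x + y) = blinfun_apply f x + blinfun_apply f y"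
    and "\<And>c x. blinfun_apply f (scale c x) = c * blinfun_apply f x"
  shows "f \<in> dual_space scale"
  using assms vector_space_mult vector_space_axioms
  by (auto simp: dual_space_def Vector_Spaces.linear_iff)

text \<open>Multiplying the argument by a unimodular scalar makes the value real.\<close>

lemma norm_le_if_Re_le:
  fixes g :: "'a \<Rightarrow> 'k"
  assumes g: "\<And>c x. g (scale c x) = c * g x"
    and le: "\<And>y. norm y = norm x \<Longrightarrow> Re (to_complex (g y)) \<le> b" and "0 \<le> b"
  shows "norm (g x) \<le> b"
proof (cases "g x = 0")
  case False
  define c where "c = of_real (norm (g x)) / g x"
  have "norm (scale c x) = norm x" using False by (simp add: norm_scale c_def norm_divide)
  then have "Re (to_complex (g (scale c x))) \<le> b" by (rule le)
  moreover have "g (scale c x) = of_real (norm (g x))" using False by (simp add: g c_def)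
  ultimately show ?thesis by simp
qed (use \<open>0 \<le> b\<close> in simp)

text \<open>Over C, a linear functional is recovered from its real part by
  \<open>g x = u x - i * u (i x)\<close>; over R, \<open>u\<close> itself serves. This carries the
  real Hahn-Banach theorem over to K.\<close>

lemma real_part_functional:
  assumes "linear (u :: 'a \<Rightarrow> real)"
  shows "\<exists>g :: 'a \<Rightarrow> 'k. (\<forall>x y. g (x + y) = g x + g y) \<and> (\<forall>c x. g (scale c x) = c * g x) \<and>
    (\<forall>x. Re (to_complex (g x)) = u x)"
proof -
  interpret u: linear u by fact
  consider "range (to_complex :: 'k \<Rightarrow> complex) = \<real>" | "range (to_complex :: 'k \<Rightarrow> complex) = UNIV"
    using range_to_complex by blast
  then show ?thesis
  proof cases
    case 1
    have c: "\<exists>r. c = of_real r" for c :: 'k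
    proof -
      have "to_complex c \<in> \<real>" using 1 by blast
      then obtain r where "to_complex c = of_real r" by (auto elim: Reals_cases)
      then have "to_complex c = to_complex (of_real r :: 'k)" by simp
      then show ?thesis unfolding to_complex_eq_iff by blast
    qed
    have "of_real (u (scale c x)) = c * of_real (u x)" for c :: 'k and x
    proof -
      obtain r where "c = of_real r" using c by blast
      then show ?thesis by (simp add: scale_of_real u.scaleR)
    qed
    then show ?thesis
      by (intro exI[where x = "\<lambda>x. of_real (u x)"]) (auto simp: u.add)
  next
    case 2
    then obtain i :: 'k where i: "to_complex i = \<i>" by (metis UNIV_I imageE)
    have "to_complex (i * i) = to_complex (of_real (- 1) :: 'k)"
      unfolding to_complex_mult i to_complex_of_real by simp
    then have "i * i = of_real (- 1)" by (simp only: to_complex_eq_iff)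
    then have ii: "i * i = - 1" by simp
    define g where "g x = of_real (u x) - i * of_real (u (scale i x))" for x
    have "g (x + y) = g x + g y" for x y
      by (simp add: g_def u.add scale_right_distrib algebra_simps)
    moreover have "g (scale c x) = c * g x" for c x
    proof -
      define a b where "a = Re (to_complex c)" and "b = Im (to_complex c)"
      have "to_complex c = to_complex (of_real a + of_real b * i)"
        by (simp add: to_complex_add to_complex_mult i a_def b_def complex_eq_iff)
      then have c: "c = of_real a + of_real b * i" by (simp only: to_complex_eq_iff)
      have "scale c x = scale (of_real a) x + scale (of_real b) (scale i x)"
        by (simp add: c scale_left_distrib)
      also have "\<dots> = a *\<^sub>R x + b *\<^sub>R scale i x"
        by (simp only: scale_of_real)
      finally have "scale c x = a *\<^sub>R x + b *\<^sub>R scale i x" .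
      then have 1: "u (scale c x) = a * u x + b * u (scale i x)" by (simp add: u.add u.scaleR)
      \<comment> \<open>With \<open>c = a + b i\<close> one has \<open>i c = a i - b\<close>, which
        supplies the second term of \<open>g (scale c x)\<close>.\<close>
      have "i * c = of_real a * i + of_real b * (i * i)" by (simp add: c algebra_simps)
      also have "\<dots> = of_real a * i - of_real b" unfolding ii by simp
      finally have "scale i (scale c x) = scale (of_real a) (scale i x) - scale (of_real b) x"
        by (simp add: scale_left_diff_distrib)
      also have "\<dots> = a *\<^sub>R scale i x - b *\<^sub>R x"
        by (simp only: scale_of_real)
      finally have 2: "u (scale i (scale c x)) = a * u (scale i x) - b * u x"
        by (simp add: u.diff u.scaleR)
      have "c * g x = of_real a * of_real (u x) + i * of_real b * of_real (u x)
          - i * of_real a * of_real (u (scale i x)) - (i * i) * of_real b * of_real (u (scale i x))"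
        by (simp add: c g_def algebra_simps)
      also have "\<dots> = g (scale c x)"
        unfolding ii g_def 1 2 by (simp add: algebra_simps)
      finally show ?thesis ..
    qed
    moreover have "Re (to_complex (g x)) = u x" for x
      by (simp add: g_def to_complex_diff to_complex_mult i)
    ultimately show ?thesis by blast
  qed
qed

text \<open>The norm itself is the dominating sublinear functional. The bound is
  \<open>\<le> 1\<close> rather than \<open>= 1\<close> so that the trivial space is
  covered.\<close>

lemma exists_norming_functional:
  "\<exists>f\<in>dual_space scale. norm f \<le> 1 \<and> blinfun_apply f x = of_real (norm x)"
proof -
  obtain u :: "'a \<Rightarrow> real" where u: "linear u" "\<And>y. u y \<le> norm y" "u x = norm x"
    using hahn_banach_sublinear[OF sublinear_norm, of x] by auto
  obtain g :: "'a \<Rightarrow> 'k" where g: "\<And>x y. g (x + y) = g x + g y" "\<And>c x. g (scale c x) = c * g x"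
    "\<And>x. Re (to_complex (g x)) = u x"
    using real_part_functional[OF u(1)] by blast
  \<comment> \<open>Domination concerns only the real part; rotating the argument extends it to the
    modulus.\<close>
  have norm_g: "norm (g y) \<le> norm y" for y
    using u(2) by (intro norm_le_if_Re_le g(2)) (auto simp: g(3), metis)
  have "g (r *\<^sub>R y) = r *\<^sub>R g y" for r y
    using g(2)[of "of_real r" y] by (simp add: scale_of_real scaleR_conv_of_real)
  then have "bounded_linear g"
    using g(1) norm_g by (intro bounded_linear_intro[where K = 1]) auto
  then have app: "blinfun_apply (Blinfun g) = g" by (rule bounded_linear_Blinfun_apply)
  have "Blinfun g \<in> dual_space scale" by (rule dual_spaceI) (auto simp: app g)
  moreover have "norm (Blinfun g) \<le> 1" by (rule norm_blinfun_bound) (auto simp: app norm_g)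
  moreover have "g x = of_real (norm x)"
    using norm_g[of x] g(3)[of x] u(3) by (intro eq_of_real_if_Re_ge_norm) auto
  ultimately show ?thesis using app by metis
qed

lemma exists_state:
  assumes "norm x = 1"
  shows "\<exists>f. (x, f) \<in> Pi_states scale"
proof -
  obtain f where f: "f \<in> dual_space scale" "norm f \<le> 1" "blinfun_apply f x = of_real (norm x)"
    using exists_norming_functional by blast
  then have "blinfun_apply f x = 1" using assms by simp
  moreover have "norm f = 1"
    using f(2) norm_blinfun[of f x] assms calculation by simp
  ultimately show ?thesis using f assms by (auto simp: Pi_states_def)
qed

end

section \<open>Weak cluster points\<close>

text \<open>A finer filter takes the place of a convergent subsequence, which compactness alone does
  not provide. It arises by adding to \<open>F\<close> the preimages of the neighbourhoods of a
  cluster point.\<close>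

lemma compact_subfilter:
  fixes xs :: "'i \<Rightarrow> 'a::topological_space"
  assumes "compact K" "F \<noteq> bot" "\<And>i. xs i \<in> K"
  shows "\<exists>l\<in>K. \<exists>G\<le>F. G \<noteq> bot \<and> (xs \<longlongrightarrow> l) G"
proof -
  have "filtermap xs F \<noteq> bot" using assms(2) by (simp add: filtermap_bot_iff)
  moreover have "eventually (\<lambda>x. x \<in> K) (filtermap xs F)"
    using assms(3) by (simp add: eventually_filtermap)
  ultimately obtain l where l: "l \<in> K" "inf (nhds l) (filtermap xs F) \<noteq> bot"
    using assms(1) unfolding compact_filter by blast
  define G where "G = inf F (filtercomap xs (nhds l))"
  \<comment> \<open>Triviality of \<open>G\<close> would give a neighbourhood of \<open>l\<close>
    that \<open>xs\<close> eventually avoids along \<open>F\<close>.\<close>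
  have "inf (nhds l) (filtermap xs F) = bot" if "G = bot"
  proof -
    have "eventually (\<lambda>i. False) (inf F (filtercomap xs (nhds l)))"
      using that by (simp add: G_def)
    then obtain Q R where QR: "eventually Q F" "eventually R (nhds l)" "\<And>i. Q i \<Longrightarrow> \<not> R (xs i)"
      by (auto simp: eventually_inf eventually_filtercomap)
    have "eventually (\<lambda>x. \<not> R x) (filtermap xs F)"
      using QR(1,3) by (auto simp: eventually_filtermap elim: eventually_mono)
    then have "eventually (\<lambda>x. False) (inf (nhds l) (filtermap xs F))"
      unfolding eventually_inf using QR(2) by blast
    then show ?thesis by (simp add: trivial_limit_def)
  qed
  then have "G \<noteq> bot" using l(2) by blast
  moreover have "(xs \<longlongrightarrow> l) (filtercomap xs (nhds l))" by (rule filterlim_filtercomap)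
  then have "(xs \<longlongrightarrow> l) G" by (rule tendsto_mono[rotated]) (simp add: G_def)
  moreover have "G \<le> F" by (simp add: G_def)
  ultimately show ?thesis using l(1) by blast
qed

text \<open>This is the Banach-Alaoglu argument in the bidual: each \<open>xs i\<close> acts by
  evaluation as a point of a compact product of scalar balls, a pointwise limit is a bounded
  functional on the dual space, and reflexivity represents it by a vector.\<close>

lemma reflexive_weak_cluster:
  fixes sX :: "'k::rc_field \<Rightarrow> 'a::banach \<Rightarrow> 'a" and xs :: "'i \<Rightarrow> 'a"
  assumes "banach_over sX" "reflexive_space sX" "F \<noteq> bot" "\<And>i. norm (xs i) \<le> 1"
  shows "\<exists>x. norm x \<le> 1 \<and> (\<exists>G\<le>F. G \<noteq> bot \<and>
    (\<forall>f\<in>dual_space sX. ((\<lambda>i. blinfun_apply f (xs i)) \<longlongrightarrow> blinfun_apply f x) G))"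
proof -
  interpret banach_over sX by fact
  let ?K = "PiE UNIV (\<lambda>f :: 'a \<Rightarrow>\<^sub>L 'k. cball (0::'k) (norm f))"
  have "compactin (product_topology (\<lambda>f :: 'a \<Rightarrow>\<^sub>L 'k. euclidean :: 'k topology) UNIV) ?K"
    by (simp add: compactin_PiE compact_cball_rc_field)
  then have "compact ?K" by (simp add: euclidean_product_topology)
  moreover have "(\<lambda>f. blinfun_apply f (xs i)) \<in> ?K" for i
  proof -
    have "norm (blinfun_apply f (xs i)) \<le> norm f" for f :: "'a \<Rightarrow>\<^sub>L 'k"
      using norm_blinfun[of f "xs i"] mult_left_mono[OF assms(4)[of i] norm_ge_zero[of f]] by simp
    then show ?thesis by auto
  qed
  ultimately obtain \<phi> G where \<phi>: "\<phi> \<in> ?K" and G: "G \<le> F" "G \<noteq> bot"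
    and lim: "((\<lambda>i f. blinfun_apply f (xs i)) \<longlongrightarrow> \<phi>) G"
    using compact_subfilter[OF _ assms(3), of ?K "\<lambda>i f. blinfun_apply f (xs i)"] by blast
  have lim_f: "((\<lambda>i. blinfun_apply f (xs i)) \<longlongrightarrow> \<phi> f) G" for f
    using continuous_on_tendsto_compose[OF continuous_on_product_coordinates lim, of f] by simp
  have "\<phi> \<in> bidual_space sX"
  proof -
    have "\<phi> (f + g) = \<phi> f + \<phi> g" for f g
      by (rule tendsto_unique[OF G(2) lim_f])
        (use tendsto_add[OF lim_f[of f] lim_f[of g]] in \<open>simp add: blinfun.add_left\<close>)
    moreover have "\<phi> (blinfun_mult_right c o\<^sub>L f) = c * \<phi> f" for c f
      by (rule tendsto_unique[OF G(2) lim_f])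
        (use tendsto_mult_left[OF lim_f[of f], of c] in simp)
    moreover have "norm (\<phi> f) \<le> 1 * norm f" for f using \<phi> by auto
    ultimately show ?thesis unfolding bidual_space_def by blast
  qed
  then obtain x where x: "\<And>f. f \<in> dual_space sX \<Longrightarrow> \<phi> f = blinfun_apply f x"
    using assms(2) unfolding reflexive_space_def by blast
  \<comment> \<open>\<open>\<phi>\<close> lies in the product of balls, so testing it on a
    functional that norms \<open>x\<close> gives \<open>norm x \<le> 1\<close>.\<close>
  obtain f where f: "f \<in> dual_space sX" "norm f \<le> 1" "blinfun_apply f x = of_real (norm x)"
    using exists_norming_functional by blast
  have "norm x \<le> 1"
    using \<phi> x[OF f(1)] f(2,3) by (auto simp: PiE_def Pi_def) (metis abs_norm_cancel norm_of_real order_trans)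
  moreover have "((\<lambda>i. blinfun_apply f (xs i)) \<longlongrightarrow> blinfun_apply f x) G" if "f \<in> dual_space sX" for f
    using lim_f[of f] x[OF that] by simp
  ultimately show ?thesis using G by blast
qed

section \<open>From weak to norm convergence\<close>

lemma kadec_klee_tendsto:
  fixes sX :: "'k::rc_field \<Rightarrow> 'a::banach \<Rightarrow> 'a"
  assumes "kadec_klee sX" "\<And>i. norm (xs i) = 1" "norm x = 1"
    and weak: "\<And>f. f \<in> dual_space sX \<Longrightarrow> ((\<lambda>i. blinfun_apply f (xs i)) \<longlongrightarrow> blinfun_apply f x) G"
  shows "(xs \<longlongrightarrow> x) G"
proof (rule topological_tendstoI)
  fix S assume S: "open S" "x \<in> S"
  have "openin (top_of_set (sphere 0 1)) (sphere 0 1 \<inter> S)" using S(1) by auto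
  then have "openin (subtopology (weak_topology sX) (sphere 0 1)) (sphere 0 1 \<inter> S)"
    using assms(1) by (simp add: kadec_klee_def)
  then obtain W where W: "openin (weak_topology sX) W" "sphere 0 1 \<inter> S = W \<inter> sphere 0 1"
    by (auto simp: openin_subtopology)
  \<comment> \<open>Weak convergence is given on functionals only; induction over the generation of
    \<open>W\<close> transfers it to this weakly open set.\<close>
  have "generate_topology_on {blinfun_apply f -` U | f U. f \<in> dual_space sX \<and> open U} W"
    using W(1) unfolding weak_topology_def by (rule openin_topology_generated_by)
  then have "x \<in> W \<longrightarrow> eventually (\<lambda>i. xs i \<in> W) G"
  proof induction
    case (Int a b)
    then show ?case by (auto intro: eventually_conj)
  next
    case (UN K)
    show ?case
    proof
      assume "x \<in> \<Union> K"
      then obtain k where k: "k \<in> K" "x \<in> k" by blast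
      then have "eventually (\<lambda>i. xs i \<in> k) G" using UN.IH by blast
      then show "eventually (\<lambda>i. xs i \<in> \<Union> K) G"
        by (rule eventually_mono) (use k(1) in blast)
    qed
  next
    case (Basis s)
    then obtain f U where "s = blinfun_apply f -` U" "f \<in> dual_space sX" "open U" by blast
    then show ?case using topological_tendstoD[OF weak] by auto
  qed simp
  moreover have "x \<in> W"
    using equalityD1[OF W(2)] S(2) assms(3) by (simp add: subset_iff)
  ultimately have "eventually (\<lambda>i. xs i \<in> W) G" by blast
  then show "eventually (\<lambda>i. xs i \<in> S) G"
    by (rule eventually_mono) (use equalityD2[OF W(2)] assms(2) in \<open>simp add: subset_iff\<close>)
qed

lemma compact_operator_cluster:
  fixes sX :: "'k::rc_field \<Rightarrow> 'a::banach \<Rightarrow> 'a" and sY :: "'k \<Rightarrow> 'b::banach \<Rightarrow> 'b"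
  assumes X: "banach_over sX" "reflexive_space sX" "kadec_klee sX" and Y: "banach_over sY"
    and T: "T \<in> compact_operators sX sY" "norm T = 1"
    and F: "F \<noteq> bot" and xs: "\<And>i. norm (xs i) = 1"
    and lim: "((\<lambda>i. norm (blinfun_apply T (xs i))) \<longlongrightarrow> 1) F"
  shows "\<exists>x. norm x = 1 \<and> norm (blinfun_apply T x) = 1 \<and> (\<exists>G\<le>F. G \<noteq> bot \<and> (xs \<longlongrightarrow> x) G)"
proof -
  interpret X: banach_over sX by fact
  interpret Y: banach_over sY by fact
  obtain x G where x: "norm x \<le> 1" and G: "G \<le> F" "G \<noteq> bot"
    and weak: "\<And>f. f \<in> dual_space sX \<Longrightarrow> ((\<lambda>i. blinfun_apply f (xs i)) \<longlongrightarrow> blinfun_apply f x) G"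
    using reflexive_weak_cluster[OF X(1,2) F, of xs] xs by auto
  have "blinfun_apply T (xs i) \<in> closure (blinfun_apply T ` cball 0 1)" for i
    using xs by (intro closure_subset[THEN subsetD]) auto
  then obtain y H where H: "H \<le> G" "H \<noteq> bot" and y: "((\<lambda>i. blinfun_apply T (xs i)) \<longlongrightarrow> y) H"
    using compact_subfilter[OF _ G(2), of "closure (blinfun_apply T ` cball 0 1)" "\<lambda>i. blinfun_apply T (xs i)"] T
    by (auto simp: compact_operators_def)
  have weakH: "((\<lambda>i. blinfun_apply f (xs i)) \<longlongrightarrow> blinfun_apply f x) H" if "f \<in> dual_space sX" for f
    using H(1) weak[OF that] by (rule tendsto_mono)
  have Tlin: "blinfun_apply T (a + b) = blinfun_apply T a + blinfun_apply T b"
    "blinfun_apply T (sX c a) = sY c (blinfun_apply T a)" for a b c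
    using T(1) by (auto simp: compact_operators_def bounded_operators_def Vector_Spaces.linear_iff)
  \<comment> \<open>A functional norming the difference of the two, composed with \<open>T\<close>,
    lies in the dual space of the domain, so weak convergence of \<open>xs\<close> applies to
    it.\<close>
  have "blinfun_apply T x = y"
  proof -
    obtain g where g: "g \<in> dual_space sY"
      "blinfun_apply g (blinfun_apply T x - y) = of_real (norm (blinfun_apply T x - y))"
      using Y.exists_norming_functional by blast
    have "g o\<^sub>L T \<in> dual_space sX"
      by (rule X.dual_spaceI) (simp_all add: Tlin dual_spaceD[OF g(1)])
    from weakH[OF this]
    have "((\<lambda>i. blinfun_apply g (blinfun_apply T (xs i))) \<longlongrightarrow> blinfun_apply g (blinfun_apply T x)) H"
      by simp
    moreover have "((\<lambda>i. blinfun_apply g (blinfun_apply T (xs i))) \<longlongrightarrow> blinfun_apply g y) H"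
      using y by (intro blinfun.tendsto tendsto_const)
    ultimately have "blinfun_apply g (blinfun_apply T x) = blinfun_apply g y"
      by (rule tendsto_unique[OF H(2)])
    then show ?thesis using g(2) by (simp add: blinfun.diff_right)
  qed
  moreover have "norm y = 1"
    using tendsto_norm[OF y] tendsto_mono[OF order_trans[OF H(1) G(1)] lim]
    by (rule tendsto_unique[OF H(2)])
  ultimately have Tx: "norm (blinfun_apply T x) = 1" by simp
  \<comment> \<open>Here \<open>norm (T x) \<le> norm x \<le> 1\<close>, and the left side is
    1.\<close>
  then have "norm x = 1" using norm_blinfun[of T x] T(2) x by simp
  moreover have "(xs \<longlongrightarrow> x) H"
    using X(3) xs \<open>norm x = 1\<close> weakH by (rule kadec_klee_tendsto)
  ultimately show ?thesis using Tx H G(1) by (meson order_trans)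
qed

lemma tendsto_1_sequentially:
  assumes "\<And>n. 1 - inverse (real (Suc n)) < a n" "\<And>n. a n \<le> 1"
  shows "a \<longlonglongrightarrow> 1"
proof (rule tendsto_sandwich[OF _ _ _ tendsto_const])
  show "(\<lambda>n. 1 - inverse (real (Suc n))) \<longlonglongrightarrow> 1"
    using tendsto_diff[OF tendsto_const LIMSEQ_inverse_real_of_nat, of 1] by simp
qed (intro always_eventually allI less_imp_le[OF assms(1)] assms(2))+

section \<open>The two inclusions\<close>

text \<open>Attainment and approximation both follow from \<open>cluster\<close>: an almost norming
  sequence comes arbitrarily close to a vector where the norm is attained.\<close>

lemma compact_operators_subset_A_norm:
  fixes sX :: "'k::rc_field \<Rightarrow> 'a::banach \<Rightarrow> 'a" and sY :: "'k \<Rightarrow> 'b::banach \<Rightarrow> 'b"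
  assumes X: "banach_over sX" "reflexive_space sX" "kadec_klee sX" and Y: "banach_over sY"
    and T: "T \<in> compact_operators sX sY" "norm T = 1"
  shows "T \<in> A_norm sX sY"
proof -
  have T_le: "norm (blinfun_apply T x) \<le> 1" if "norm x = 1" for x
    using norm_blinfun[of T x] T(2) that by simp
  have cluster: "\<exists>x. norm x = 1 \<and> norm (blinfun_apply T x) = 1 \<and> (\<forall>\<epsilon>>0. \<exists>n. norm (x - xs n) < \<epsilon>)"
    if xs: "\<And>n. norm (xs n) = 1"
      "\<And>n. 1 - inverse (real (Suc n)) < norm (blinfun_apply T (xs n))" for xs :: "nat \<Rightarrow> 'a"
  proof -
    have "(\<lambda>n. norm (blinfun_apply T (xs n))) \<longlonglongrightarrow> 1"
      using xs T_le by (intro tendsto_1_sequentially) auto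
    then obtain x G where x: "norm x = 1" "norm (blinfun_apply T x) = 1"
      and G: "G \<noteq> bot" "(xs \<longlongrightarrow> x) G"
      using compact_operator_cluster[OF X Y T sequentially_bot, of xs] xs(1) by blast
    have "\<exists>n. norm (x - xs n) < \<epsilon>" if "0 < \<epsilon>" for \<epsilon>
      using eventually_happens'[OF G(1) tendstoD[OF G(2) that]]
      by (simp add: dist_norm norm_minus_commute)
    then show ?thesis using x by blast
  qed
  have "norm_attaining T"
  proof -
    have "\<exists>x. norm x = 1 \<and> 1 - inverse (real (Suc n)) < norm (blinfun_apply T x)" for n
    proof (rule ccontr)
      let ?b = "1 - inverse (real (Suc n))"
      assume "\<nexists>x. norm x = 1 \<and> ?b < norm (blinfun_apply T x)"
      then have le: "norm (blinfun_apply T x) \<le> ?b" if "norm x = 1" for x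
        using that by (meson not_le)
      \<comment> \<open>By homogeneity a bound below 1 on the sphere bounds the operator norm,
        provided it is nonnegative; for \<open>n = 0\<close> it equals 0.\<close>
      have "0 \<le> ?b" by (simp add: field_simps)
      have "norm (blinfun_apply T x) \<le> ?b * norm x" for x
      proof (cases "x = 0")
        case False
        have "norm (blinfun_apply T (sgn x)) \<le> ?b" using False by (intro le) (simp add: norm_sgn)
        then show ?thesis
          using False by (simp add: sgn_div_norm blinfun.scaleR_right field_simps)
      qed simp
      with \<open>0 \<le> ?b\<close> have "norm T \<le> ?b" by (rule norm_blinfun_bound)
      then show False using T(2) by simp
    qed
    then obtain xs where "\<And>n. norm (xs n) = 1"
      "\<And>n. 1 - inverse (real (Suc n)) < norm (blinfun_apply T (xs n))" by metis
    then show ?thesis using cluster[of xs] T(2) by (auto simp: norm_attaining_def)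
  qed
  moreover have "\<exists>\<eta>>0. \<forall>x\<in>sphere 0 1. norm (blinfun_apply T x) > 1 - \<eta> \<longrightarrow>
      (\<exists>x0\<in>sphere 0 1. norm (blinfun_apply T x0) = 1 \<and> norm (x0 - x) < \<epsilon>)" if "0 < \<epsilon>" for \<epsilon>
  proof (rule ccontr)
    assume neg: "\<not> ?thesis"
    \<comment> \<open>Failure for every \<open>\<eta> = inverse (real (Suc n))\<close> yields a
      sequence at distance at least \<open>\<epsilon>\<close> from all norm-attaining unit vectors,
      against \<open>cluster\<close>.\<close>
    have "\<exists>x. norm x = 1 \<and> 1 - inverse (real (Suc n)) < norm (blinfun_apply T x) \<and>
        (\<forall>x0. norm x0 = 1 \<and> norm (blinfun_apply T x0) = 1 \<longrightarrow> \<not> norm (x0 - x) < \<epsilon>)" for n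
    proof -
      have "0 < inverse (real (Suc n))" by simp
      with neg show ?thesis by (metis mem_sphere_0)
    qed
    then obtain xs where "\<And>n. norm (xs n) = 1"
      "\<And>n. 1 - inverse (real (Suc n)) < norm (blinfun_apply T (xs n))"
      "\<And>n x0. norm x0 = 1 \<Longrightarrow> norm (blinfun_apply T x0) = 1 \<Longrightarrow> \<not> norm (x0 - xs n) < \<epsilon>" by metis
    then show False using cluster[of xs] \<open>0 < \<epsilon>\<close> by blast
  qed
  ultimately show ?thesis using T by (auto simp: A_norm_def compact_operators_def)
qed

text \<open>Shmulyan's lemma. The derivative cancels in \<open>norm (x + h) + norm (x - h)\<close>, and evaluating
  \<open>g\<close> at \<open>x + h\<close> and \<open>f\<close> at \<open>x - h\<close> bounds the real part of \<open>(g - f) h\<close>.\<close>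

lemma differentiable_norm_states_close:
  fixes sX :: "'k::rc_field \<Rightarrow> 'a::banach \<Rightarrow> 'a"
  assumes "banach_over sX" and diff: "(norm :: 'a \<Rightarrow> real) differentiable (at x)" and x: "norm x = 1"
    and f: "f \<in> dual_space sX" "norm f \<le> 1" "blinfun_apply f x = 1" and "0 < \<epsilon>"
  shows "\<exists>\<delta>>0. \<forall>g\<in>dual_space sX. norm g \<le> 1 \<longrightarrow> norm (blinfun_apply g x - 1) < \<delta> \<longrightarrow> norm (g - f) \<le> \<epsilon>"
proof -
  interpret banach_over sX by fact
  obtain D where D: "(norm has_derivative D) (at x)" using diff by (auto simp: differentiable_def)
  then interpret D: bounded_linear D by (rule has_derivative_bounded_linear)
  \<comment> \<open>The error \<open>\<epsilon> / 4\<close> is incurred at both \<open>x + h\<close>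
    and \<open>x - h\<close>, hence \<open>\<epsilon> / 2\<close> in \<open>smooth\<close>.\<close>
  obtain d where d: "0 < d"
    "\<And>y. norm (y - x) < d \<Longrightarrow> norm (norm y - norm x - D (y - x)) \<le> \<epsilon> / 4 * norm (y - x)"
    using D[unfolded has_derivative_at_alt] \<open>0 < \<epsilon>\<close> by (metis divide_pos_pos zero_less_numeral)
  have smooth: "norm (x + h) + norm (x - h) \<le> 2 + \<epsilon> / 2 * norm h" if "norm h < d" for h
      proof -
    have "\<bar>norm (x + h) - 1 - D h\<bar> \<le> \<epsilon> / 4 * norm h" "\<bar>norm (x - h) - 1 + D h\<bar> \<le> \<epsilon> / 4 * norm h"
      using d(2)[of "x + h"] d(2)[of "x - h"] that x by (simp_all add: linear_neg[OF D.linear])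
    then show ?thesis by argo
  qed
  \<comment> \<open>By homogeneity it suffices to control \<open>g - f\<close> on one sphere of
    radius strictly below \<open>d\<close>.\<close>
  define s where "s = d / 2"
  have s: "0 < s" "s < d" using d(1) by (auto simp: s_def)
  have Re_le: "Re (to_complex (blinfun_apply k z)) \<le> norm z" if "norm k \<le> 1" for k :: "'a \<Rightarrow>\<^sub>L 'k" and z
  proof -
    have "Re (to_complex (blinfun_apply k z)) \<le> norm (blinfun_apply k z)"
      using complex_Re_le_cmod[of "to_complex (blinfun_apply k z)"] by (simp add: norm_to_complex)
    also have "\<dots> \<le> norm k * norm z" by (rule norm_blinfun)
    also have "\<dots> \<le> norm z" using mult_right_mono[OF that norm_ge_zero[of z]] by simp
    finally show ?thesis .
  qed
  \<comment> \<open>Of the allowance \<open>\<epsilon> * s\<close> on that sphere, half comes from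
    smoothness and half from \<open>g x\<close> being close to 1; this gives
    \<open>\<delta> = \<epsilon> * s / 2\<close>.\<close>
  have "norm (g - f) \<le> \<epsilon>"
    if g: "g \<in> dual_space sX" "norm g \<le> 1" "norm (blinfun_apply g x - 1) < \<epsilon> * s / 2" for g
  proof (rule norm_blinfun_bound)
    fix z :: 'a
    have gf: "blinfun_apply (g - f) (sX c y) = c * blinfun_apply (g - f) y" for c y
      by (simp add: blinfun.diff_left dual_spaceD(2)[OF g(1)] dual_spaceD(2)[OF f(1)] algebra_simps)
    have small: "norm (blinfun_apply (g - f) h) \<le> \<epsilon> * s" if "norm h = s" for h
    proof (rule norm_le_if_Re_le[OF gf])
      fix y :: 'a assume "norm y = norm h"
      then have y: "norm y = s" using that by simp
      \<comment> \<open>Since \<open>f x = 1\<close>, the left side is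
        \<open>1 + Re (g x) + Re ((g - f) y)\<close>.\<close>
      have "Re (to_complex (blinfun_apply g (x + y))) + Re (to_complex (blinfun_apply f (x - y)))
          \<le> norm (x + y) + norm (x - y)"
        using Re_le[OF g(2)] Re_le[OF f(2)] by (rule add_mono)
      also have "\<dots> \<le> 2 + \<epsilon> / 2 * s" using smooth[of y] s y by simp
      finally have "Re (to_complex (blinfun_apply (g - f) y))
          \<le> 1 - Re (to_complex (blinfun_apply g x)) + \<epsilon> / 2 * s"
        by (simp add: blinfun.add_right blinfun.diff_right blinfun.diff_left f(3) to_complex_add to_complex_diff)
      moreover have "1 - Re (to_complex (blinfun_apply g x)) \<le> \<epsilon> * s / 2"
        using abs_Re_le_cmod[of "to_complex (blinfun_apply g x - 1)"] g(3)
          norm_to_complex[of "blinfun_apply g x - 1"]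
        by (simp add: to_complex_diff)
      ultimately show "Re (to_complex (blinfun_apply (g - f) y)) \<le> \<epsilon> * s" by simp
    qed (use \<open>0 < \<epsilon>\<close> s in simp)
    show "norm (blinfun_apply (g - f) z) \<le> \<epsilon> * norm z"
    proof (cases "z = 0")
      case False
      have "norm (blinfun_apply (g - f) (s *\<^sub>R sgn z)) \<le> \<epsilon> * s"
        using False s by (intro small) (simp add: norm_sgn)
      then have "s * (norm (blinfun_apply (g - f) z) / norm z) \<le> s * \<epsilon>"
        using s by (simp add: blinfun.scaleR_right sgn_div_norm divide_inverse mult.commute)
      then have "norm (blinfun_apply (g - f) z) / norm z \<le> \<epsilon>"
        using s(1) by (rule mult_left_le_imp_le)
      then show ?thesis using False by (simp add: field_simps)
    qed simp
  qed (use \<open>0 < \<epsilon>\<close> in simp)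
  moreover have "0 < \<epsilon> * s / 2" using \<open>0 < \<epsilon>\<close> s by simp
  ultimately show ?thesis by blast
qed

text \<open>Only the vectors need a compactness argument; by Shmulyan's lemma the functionals then
  converge along the same filter.\<close>

lemma compact_operators_subset_A_nu:
  fixes sX :: "'k::rc_field \<Rightarrow> 'a::banach \<Rightarrow> 'a"
  assumes X: "banach_over sX" "reflexive_space sX" "kadec_klee sX"
    and diff: "frechet_differentiable_norm TYPE('a)"
    and T: "T \<in> compact_operators sX sX" "norm T = 1" "numerical_radius sX T = 1"
  shows "T \<in> A_nu sX"
proof -
  interpret banach_over sX by fact
  have T_le: "norm (blinfun_apply f (blinfun_apply T x)) \<le> norm (blinfun_apply T x)"
    "norm (blinfun_apply T x) \<le> 1" if "(x, f) \<in> Pi_states sX" for x f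
    using norm_blinfun[of T x] norm_blinfun[of f "blinfun_apply T x"] T(2) that
    by (auto simp: Pi_states_def)
  have cluster: "\<exists>x f. (x, f) \<in> Pi_states sX \<and> norm (blinfun_apply f (blinfun_apply T x)) = 1 \<and>
      (\<forall>\<epsilon>>0. \<exists>n. norm (x - xs n) < \<epsilon> \<and> norm (f - fs n) < \<epsilon>)"
    if states: "\<And>n. (xs n, fs n) \<in> Pi_states sX"
      and big: "\<And>n. 1 - inverse (real (Suc n)) < norm (blinfun_apply (fs n) (blinfun_apply T (xs n)))"
    for xs :: "nat \<Rightarrow> 'a" and fs :: "nat \<Rightarrow> 'a \<Rightarrow>\<^sub>L 'k"
  proof -
    have xs: "\<And>n. norm (xs n) = 1" and fs: "\<And>n. fs n \<in> dual_space sX" "\<And>n. norm (fs n) = 1"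
      "\<And>n. blinfun_apply (fs n) (xs n) = 1"
      using states by (auto simp: Pi_states_def)
    \<comment> \<open>On states \<open>norm (f (T x)) \<le> norm (T x) \<le> 1\<close>, so
      \<open>xs\<close> is almost norming for \<open>T\<close>.\<close>
    have lim_T: "(\<lambda>n. norm (blinfun_apply T (xs n))) \<longlonglongrightarrow> 1"
      using big T_le[OF states] by (intro tendsto_1_sequentially) (auto intro: less_le_trans)
    have lim_fT: "(\<lambda>n. norm (blinfun_apply (fs n) (blinfun_apply T (xs n)))) \<longlonglongrightarrow> 1"
      using big T_le[OF states] by (intro tendsto_1_sequentially) (auto intro: order_trans)
    obtain x G where x: "norm x = 1" and G: "G \<le> sequentially" "G \<noteq> bot" "(xs \<longlongrightarrow> x) G"
      using compact_operator_cluster[OF X X(1) T(1,2) sequentially_bot, of xs] xs lim_T by blast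
    obtain f where state: "(x, f) \<in> Pi_states sX" using exists_state[OF x] by blast
    then have f: "f \<in> dual_space sX" "norm f \<le> 1" "blinfun_apply f x = 1"
      by (auto simp: Pi_states_def)
    have "(fs \<longlongrightarrow> f) G"
    proof (rule tendstoI)
      fix e :: real assume e: "0 < e"
      then obtain \<delta> where \<delta>: "0 < \<delta>" "\<And>g. g \<in> dual_space sX \<Longrightarrow> norm g \<le> 1 \<Longrightarrow>
          norm (blinfun_apply g x - 1) < \<delta> \<Longrightarrow> norm (g - f) \<le> e / 2"
        using differentiable_norm_states_close[OF X(1) _ x f, of "e / 2"] diff x
        by (auto simp: frechet_differentiable_norm_def)
      \<comment> \<open>\<open>fs n\<close> has norm 1 and takes the value 1 at
        \<open>xs n\<close>.\<close>
      have "norm (blinfun_apply (fs n) x - 1) \<le> dist (xs n) x" for n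
        using norm_blinfun[of "fs n" "x - xs n"] fs(2,3)[of n]
        by (simp add: blinfun.diff_right dist_norm norm_minus_commute)
      then have "dist (xs n) x < \<delta> \<Longrightarrow> dist (fs n) f < e" for n
        using \<delta>(2)[OF fs(1), of n] fs(2)[of n] e by (fastforce simp: dist_norm intro: le_less_trans)
      then show "eventually (\<lambda>n. dist (fs n) f < e) G"
        using tendstoD[OF G(3) \<delta>(1)] by (auto elim: eventually_mono)
    qed
    then have "((\<lambda>n. norm (blinfun_apply (fs n) (blinfun_apply T (xs n)))) \<longlongrightarrow>
        norm (blinfun_apply f (blinfun_apply T x))) G"
      using G(3) by (intro tendsto_intros)
    then have "norm (blinfun_apply f (blinfun_apply T x)) = 1"
      using tendsto_mono[OF G(1) lim_fT] by (rule tendsto_unique[OF G(2)])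
    moreover have "\<exists>n. norm (x - xs n) < \<epsilon> \<and> norm (f - fs n) < \<epsilon>" if "0 < \<epsilon>" for \<epsilon>
      using eventually_happens'[OF G(2) eventually_conj[OF tendstoD[OF G(3) that] tendstoD[OF \<open>(fs \<longlongrightarrow> f) G\<close> that]]]
      by (simp add: dist_norm norm_minus_commute)
    ultimately show ?thesis using state by blast
  qed
  have "numerical_radius_attaining sX T"
  proof -
    let ?v = "\<lambda>(x, f). norm (blinfun_apply f (blinfun_apply T x))"
    \<comment> \<open>A nonzero operator has a nonzero vector in its domain, whose normalisation
      carries a state; so the supremum is over a nonempty set.\<close>
    have "T \<noteq> 0" using T(2) by auto
    then obtain y where "blinfun_apply T y \<noteq> 0" by (metis blinfun_eqI zero_blinfun.rep_eq)
    then have "norm (sgn y) = 1" by (auto simp: norm_sgn)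
    then have ne: "Pi_states sX \<noteq> {}" using exists_state by blast
    have bdd: "bdd_above (?v ` Pi_states sX)"
      by (intro bdd_aboveI2[where M = 1]) (auto intro: order_trans[OF T_le])
    have "\<exists>x f. (x, f) \<in> Pi_states sX \<and>
        1 - inverse (real (Suc n)) < norm (blinfun_apply f (blinfun_apply T x))" for n
    proof -
      have "1 - inverse (real (Suc n)) < (SUP s\<in>Pi_states sX. ?v s)"
        using T(3) by (simp add: numerical_radius_def)
      then show ?thesis using less_cSUP_iff[OF ne bdd] by auto
    qed
    then obtain xs fs where "\<And>n. (xs n, fs n) \<in> Pi_states sX"
      "\<And>n. 1 - inverse (real (Suc n)) < norm (blinfun_apply (fs n) (blinfun_apply T (xs n)))" by metis
    then show ?thesis
      using cluster[of xs fs] T(3) by (auto simp: numerical_radius_attaining_def)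
  qed
  moreover have "\<exists>\<eta>>0. \<forall>(x, f)\<in>Pi_states sX.
      norm (blinfun_apply f (blinfun_apply T x)) > 1 - \<eta> \<longrightarrow>
      (\<exists>(x0, f0)\<in>Pi_states sX. norm (blinfun_apply f0 (blinfun_apply T x0)) = 1 \<and>
         norm (x0 - x) < \<epsilon> \<and> norm (f0 - f) < \<epsilon>)" if "0 < \<epsilon>" for \<epsilon>
  proof (rule ccontr)
    assume neg: "\<not> ?thesis"
    \<comment> \<open>Failure for all these \<open>\<eta>\<close> yields states that differ from
      every attaining state by at least \<open>\<epsilon>\<close> in some component, against
      \<open>cluster\<close>.\<close>
    have "\<exists>x f. (x, f) \<in> Pi_states sX \<and>
        1 - inverse (real (Suc n)) < norm (blinfun_apply f (blinfun_apply T x)) \<and>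
        (\<forall>x0 f0. (x0, f0) \<in> Pi_states sX \<and> norm (blinfun_apply f0 (blinfun_apply T x0)) = 1 \<longrightarrow>
          \<not> (norm (x0 - x) < \<epsilon> \<and> norm (f0 - f) < \<epsilon>))" for n
    proof -
      have "0 < inverse (real (Suc n))" by simp
      then have "\<not> (\<forall>(x, f)\<in>Pi_states sX.
          norm (blinfun_apply f (blinfun_apply T x)) > 1 - inverse (real (Suc n)) \<longrightarrow>
          (\<exists>(x0, f0)\<in>Pi_states sX. norm (blinfun_apply f0 (blinfun_apply T x0)) = 1 \<and>
            norm (x0 - x) < \<epsilon> \<and> norm (f0 - f) < \<epsilon>))"
        using neg by blast
      then obtain x f where xf: "(x, f) \<in> Pi_states sX"
        "1 - inverse (real (Suc n)) < norm (blinfun_apply f (blinfun_apply T x))"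
        "\<not> (\<exists>(x0, f0)\<in>Pi_states sX. norm (blinfun_apply f0 (blinfun_apply T x0)) = 1 \<and>
            norm (x0 - x) < \<epsilon> \<and> norm (f0 - f) < \<epsilon>)"
        by (auto split: prod.splits)
      show ?thesis
        by (intro exI[where x = x] exI[where x = f] conjI xf(1,2)) (use xf(3) in blast)
    qed
    then obtain xs fs where "\<And>n. (xs n, fs n) \<in> Pi_states sX"
      "\<And>n. 1 - inverse (real (Suc n)) < norm (blinfun_apply (fs n) (blinfun_apply T (xs n)))"
      "\<And>n x0 f0. (x0, f0) \<in> Pi_states sX \<Longrightarrow> norm (blinfun_apply f0 (blinfun_apply T x0)) = 1 \<Longrightarrow>
        \<not> (norm (x0 - xs n) < \<epsilon> \<and> norm (f0 - fs n) < \<epsilon>)" by metis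
    then show False using cluster[of xs fs] \<open>0 < \<epsilon>\<close> by blast
  qed
  ultimately show ?thesis using T by (auto simp: A_nu_def compact_operators_def)
qed

theorem theorem2p5:
  fixes sX :: "'k::rc_field \<Rightarrow> 'a::banach \<Rightarrow> 'a"
  assumes "banach_over sX"
    and "reflexive_space sX"
    and "kadec_klee sX"
  shows "(\<forall>sY :: 'k \<Rightarrow> 'b::banach \<Rightarrow> 'b. banach_over sY \<longrightarrow>
            {T \<in> compact_operators sX sY. norm T = 1} \<subseteq> A_norm sX sY) \<and>
         (frechet_differentiable_norm TYPE('a) \<longrightarrow>
            {T \<in> compact_operators sX sX. numerical_radius sX T = 1 \<and> norm T = 1} \<subseteq> A_nu sX)"
proof (intro conjI allI impI subsetI)
  fix sY :: "'k \<Rightarrow> 'b \<Rightarrow> 'b" and T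
  assume "banach_over sY" "T \<in> {T \<in> compact_operators sX sY. norm T = 1}"
  then show "T \<in> A_norm sX sY" by (simp add: compact_operators_subset_A_norm[OF assms])
next
  fix T
  assume "frechet_differentiable_norm TYPE('a)"
    "T \<in> {T \<in> compact_operators sX sX. numerical_radius sX T = 1 \<and> norm T = 1}"
  then show "T \<in> A_nu sX" by (simp add: compact_operators_subset_A_nu[OF assms])
qed

end
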